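(* The rewrite systems $\to_a$ and $\to_\ell$ are AC-strongly-normalising: for each $R\in\{\to_a,\to_\ell\}$ and every term $M$ there is a number $n$ such that every $R$-rewrite sequence starting at $M$ contains fewer than $n$ steps that are not instances of the rules Asso or Com.
   Context: Fix a ring of scalars (elements $\alpha,\beta$). Terms: $M,N,L ::= V \mid (M)~N \mid \alpha.M \mid M+N$; values $V,W ::= 0 \mid B \mid \alpha.V \mid V+W$; base terms $B ::= x \mid \lambda x\,M$. Rewrite rules: $(A)$ $(M+N)~L\to (M)~L+(N)~L$; $(\alpha.M)~N\to\alpha.(M)~N$; $(0)~M\to 0$. $(A_l)$ $(M+N)~V\to(M)~V+(N)~V$; $(\alpha.M)~V\to\alpha.(M)~V$; $(0)~V\to 0$ ($V$ value). $(A_r)$ $(B)~(M+N)\to(B)~M+(B)~N$; $(B)~(\alpha.M)\to\alpha.(B)~M$; $(B)~0\to 0$ ($B$ base term). (Asso) $M+(N+L)\to(M+N)+L$ and $(M+N)+L\to M+(N+L)$. (Com) $M+N\to N+M$. $(F)$ $\alpha.M+\beta.M\to(\alpha+\beta).M$; $\alpha.M+M\to(\alpha+1).M$; $M+M\to(1+1).M$; $\alpha.(\beta.M)\to(\alpha\beta).M$. $(S)$ $\alpha.(M+N)\to\alpha.M+\alpha.N$; $1.M\to M$; $0.M\to 0$; $\alpha.0\to 0$; $0+M\to M$. Context rules $(\xi)$: from $M\to M'$ infer $(M)~N\to(M')~N$, $M+N\to M'+N$, $N+M\to N+M'$, $\alpha.M\to\alpha.M'$; $(\xi_{lin})$: from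 $M\to M'$ infer $(V)~M\to(V)~M'$ for $V$ a value. $\to_a$ is generated by $A\cup\mathrm{Asso}\cup\mathrm{Com}\cup F\cup S$ closed under $\xi$; $\to_\ell$ by $A_l\cup A_r\cup\mathrm{Asso}\cup\mathrm{Com}\cup F\cup S$ closed under $\xi,\xi_{lin}$. Each rewrite step applies one base rule inside a context; a step is an Asso/Com step if that rule is Asso or Com. *)

theory Defs
  imports Main "HOL-Library.Extended_Nat"
begin

text \<open>Terms are taken up to renaming of bound variables, by means of de Bruijn indices.\<close>

datatype 'a tm =
    Var nat
  | Lam "'a tm"
  | Zero
  | App "'a tm" "'a tm" (infixl \<open>\<cdot>\<close> 80)
  | Scale 'a "'a tm" (infixr \<open>\<odot>\<close> 75)
  | Plus "'a tm" "'a tm" (infixl \<open>\<oplus>\<close> 65)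

inductive base_term :: "'a tm \<Rightarrow> bool" where
  "base_term (Var x)"
| "base_term (Lam M)"

inductive is_value :: "'a tm \<Rightarrow> bool" where
  "is_value Zero"
| "base_term B \<Longrightarrow> is_value B"
| "is_value V \<Longrightarrow> is_value (\<alpha> \<odot> V)"
| "is_value V \<Longrightarrow> is_value W \<Longrightarrow> is_value (V \<oplus> W)"

datatype rule_group = Rule_A | Rule_Al | Rule_Ar | Asso | Com | Rule_F | Rule_S

text \<open>
  The sort {ring, monoid_mult} is that of all rings with unit, not necessarily commutative;
  unlike ring_1 it does not exclude the trivial ring.
\<close>

inductive base_rule ::
  "rule_group \<Rightarrow> 'a::{ring, monoid_mult} tm \<Rightarrow> 'a tm \<Rightarrow> bool" where
  "base_rule Rule_A ((M \<oplus> N) \<cdot> L) (M \<cdot> L \<oplus> N \<cdot> L)"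
| "base_rule Rule_A ((\<alpha> \<odot> M) \<cdot> N) (\<alpha> \<odot> (M \<cdot> N))"
| "base_rule Rule_A (Zero \<cdot> M) Zero"

| "is_value V \<Longrightarrow> base_rule Rule_Al ((M \<oplus> N) \<cdot> V) (M \<cdot> V \<oplus> N \<cdot> V)"
| "is_value V \<Longrightarrow> base_rule Rule_Al ((\<alpha> \<odot> M) \<cdot> V) (\<alpha> \<odot> (M \<cdot> V))"
| "is_value V \<Longrightarrow> base_rule Rule_Al (Zero \<cdot> V) Zero"

| "base_term B \<Longrightarrow> base_rule Rule_Ar (B \<cdot> (M \<oplus> N)) (B \<cdot> M \<oplus> B \<cdot> N)"
| "base_term B \<Longrightarrow> base_rule Rule_Ar (B \<cdot> (\<alpha> \<odot> M)) (\<alpha> \<odot> (B \<cdot> M))"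
| "base_term B \<Longrightarrow> base_rule Rule_Ar (B \<cdot> Zero) Zero"

| "base_rule Asso (M \<oplus> (N \<oplus> L)) ((M \<oplus> N) \<oplus> L)"
| "base_rule Asso ((M \<oplus> N) \<oplus> L) (M \<oplus> (N \<oplus> L))"

| "base_rule Com (M \<oplus> N) (N \<oplus> M)"

| "base_rule Rule_F (\<alpha> \<odot> M \<oplus> \<beta> \<odot> M) ((\<alpha> + \<beta>) \<odot> M)"
| "base_rule Rule_F (\<alpha> \<odot> M \<oplus> M) ((\<alpha> + 1) \<odot> M)"
| "base_rule Rule_F (M \<oplus> M) ((1 + 1) \<odot> M)"
| "base_rule Rule_F (\<alpha> \<odot> (\<beta> \<odot> M)) ((\<alpha> * \<beta>) \<odot> M)"

| "base_rule Rule_S (\<alpha> \<odot> (M \<oplus> N)) (\<alpha> \<odot> M \<oplus> \<alpha> \<odot> N)"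
| "base_rule Rule_S (1 \<odot> M) M"
| "base_rule Rule_S (0 \<odot> M) Zero"
| "base_rule Rule_S (\<alpha> \<odot> Zero) Zero"
| "base_rule Rule_S (Zero \<oplus> M) M"

text \<open>
  A step carries the group of the base rule it applies, since the same pair of terms may be
  related both by an Asso or Com step and by a step of another group.
\<close>

inductive step_a ::
  "rule_group \<Rightarrow> 'a::{ring, monoid_mult} tm \<Rightarrow> 'a tm \<Rightarrow> bool" where
  rule: "g \<in> {Rule_A, Asso, Com, Rule_F, Rule_S} \<Longrightarrow> base_rule g M M' \<Longrightarrow> step_a g M M'"
| xi_app: "step_a g M M' \<Longrightarrow> step_a g (M \<cdot> N) (M' \<cdot> N)"
| xi_plus_left: "step_a g M M' \<Longrightarrow> step_a g (M \<oplus> N) (M' \<oplus> N)"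
| xi_plus_right: "step_a g M M' \<Longrightarrow> step_a g (N \<oplus> M) (N \<oplus> M')"
| xi_scale: "step_a g M M' \<Longrightarrow> step_a g (\<alpha> \<odot> M) (\<alpha> \<odot> M')"

inductive step_l ::
  "rule_group \<Rightarrow> 'a::{ring, monoid_mult} tm \<Rightarrow> 'a tm \<Rightarrow> bool" where
  rule: "g \<in> {Rule_Al, Rule_Ar, Asso, Com, Rule_F, Rule_S} \<Longrightarrow> base_rule g M M' \<Longrightarrow> step_l g M M'"
| xi_app: "step_l g M M' \<Longrightarrow> step_l g (M \<cdot> N) (M' \<cdot> N)"
| xi_plus_left: "step_l g M M' \<Longrightarrow> step_l g (M \<oplus> N) (M' \<oplus> N)"
| xi_plus_right: "step_l g M M' \<Longrightarrow> step_l g (N \<oplus> M) (N \<oplus> M')"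
| xi_scale: "step_l g M M' \<Longrightarrow> step_l g (\<alpha> \<odot> M) (\<alpha> \<odot> M')"
| xi_lin: "is_value V \<Longrightarrow> step_l g M M' \<Longrightarrow> step_l g (V \<cdot> M) (V \<cdot> M')"

text \<open>
  A rewrite sequence has len steps, len possibly infinite; its i-th step leads from t i
  to t (Suc i) by a rule of group g i.
\<close>

definition rewrite_seq ::
  "(rule_group \<Rightarrow> 'a tm \<Rightarrow> 'a tm \<Rightarrow> bool) \<Rightarrow> enat \<Rightarrow> (nat \<Rightarrow> rule_group) \<Rightarrow> (nat \<Rightarrow> 'a tm) \<Rightarrow> bool"
  where "rewrite_seq R len g t \<longleftrightarrow> (\<forall>i. enat i < len \<longrightarrow> R (g i) (t i) (t (Suc i)))"

definition non_AC_steps :: "enat \<Rightarrow> (nat \<Rightarrow> rule_group) \<Rightarrow> nat set" where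
  "non_AC_steps len g = {i. enat i < len \<and> g i \<notin> {Asso, Com}}"

definition AC_strongly_normalising ::
  "(rule_group \<Rightarrow> 'a tm \<Rightarrow> 'a tm \<Rightarrow> bool) \<Rightarrow> bool" where
  "AC_strongly_normalising R \<longleftrightarrow>
    (\<forall>M. \<exists>n. \<forall>len g t. rewrite_seq R len g t \<and> t 0 = M \<longrightarrow>
      finite (non_AC_steps len g) \<and> card (non_AC_steps len g) < n)"

end

(* A polynomial interpretation in the natural numbers, associative and commutative on sums,
   is preserved by Asso and Com and strictly decreased by every other rule in every context.
   Hence the weight of the initial term bounds the number of steps outside Asso and Com. *)

theory Submission imports Defs begin

text \<open>The product for application is symmetric, so distribution on the left and on the right
  are the same computation; coefficient 3 and offset 2 leave room for the constants of sums and
  scalings. The 2 in a sum pays for \<open>M \<oplus> M\<close> becoming a scaling and for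
  distributing a scalar. Scalars are ignored, and abstractions weigh 0 because no step reduces under
  them.\<close>

fun weight :: "'a tm \<Rightarrow> nat" where
  "weight (Var x) = 0"
| "weight (Lam M) = 0"
| "weight Zero = 0"
| "weight (M \<cdot> N) = (3 * weight M + 2) * (3 * weight N + 2)"
| "weight (\<alpha> \<odot> M) = 2 * weight M + 1"
| "weight (M \<oplus> N) = weight M + weight N + 2"

lemma base_rule_weight_AC:
  "base_rule g M M' \<Longrightarrow> g \<in> {Asso, Com} \<Longrightarrow> weight M' = weight M"
  by (induction rule: base_rule.induct) auto

lemma base_rule_weight_less:
  "base_rule g M M' \<Longrightarrow> g \<notin> {Asso, Com} \<Longrightarrow> weight M' < weight M"
  by (induction rule: base_rule.induct) (auto simp: algebra_simps)

lemma step_a_weight_AC: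
  "step_a g M M' \<Longrightarrow> g \<in> {Asso, Com} \<Longrightarrow> weight M' = weight M"
  by (induction rule: step_a.induct) (use base_rule_weight_AC in auto)

lemma step_a_weight_less:
  "step_a g M M' \<Longrightarrow> g \<notin> {Asso, Com} \<Longrightarrow> weight M' < weight M"
proof (induction rule: step_a.induct)
  case (rule g M M')
  then show ?case using base_rule_weight_less by blast
qed (auto intro!: add_less_le_mono)

lemma step_l_weight_AC:
  "step_l g M M' \<Longrightarrow> g \<in> {Asso, Com} \<Longrightarrow> weight M' = weight M"
  by (induction rule: step_l.induct) (use base_rule_weight_AC in auto)

text \<open>The weight is strictly monotone in every argument; for application, under
  \<open>xi_app\<close> and \<open>xi_lin\<close>, because the other factor is at least 2.\<close>

lemma step_l_weight_less:
  "step_l g M M' \<Longrightarrow> g \<notin> {Asso, Com} \<Longrightarrow> weight M' < weight M"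
proof (induction rule: step_l.induct)
  case (rule g M M')
  then show ?case using base_rule_weight_less by blast
qed (auto intro!: add_less_le_mono)

lemma AC_strongly_normalising_if_measure:
  fixes f :: "'a tm \<Rightarrow> nat"
  assumes AC: "\<And>g M M'. R g M M' \<Longrightarrow> g \<in> {Asso, Com} \<Longrightarrow> f M' = f M"
    and less: "\<And>g M M'. R g M M' \<Longrightarrow> g \<notin> {Asso, Com} \<Longrightarrow> f M' < f M"
  shows "AC_strongly_normalising R"
  unfolding AC_strongly_normalising_def
proof (intro allI exI impI, elim conjE)
  fix M len g t
  assume seq: "rewrite_seq R len g t" and t0: "t 0 = M"
  \<comment> \<open>Keeping the remaining measure in the sum makes it non-increasing along the
    sequence: each strict step adds one to the count and takes at least one from
    \<open>f\<close>.\<close>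
  have bound: "card (non_AC_steps (enat k) g) + f (t k) \<le> f M" if "enat k \<le> len" for k
    using that
  proof (induction k)
    case 0
    then show ?case by (simp add: non_AC_steps_def t0 flip: zero_enat_def)
  next
    case (Suc k)
    have lt: "enat k < len"
      using Suc.prems by (simp add: Suc_ile_eq)
    then have step: "R (g k) (t k) (t (Suc k))"
      using seq by (simp add: rewrite_seq_def)
    have IH: "card (non_AC_steps (enat k) g) + f (t k) \<le> f M"
      using Suc.IH lt by simp
    show ?case
    proof (cases "g k \<in> {Asso, Com}")
      case True
      then have "non_AC_steps (enat (Suc k)) g = non_AC_steps (enat k) g"
        by (auto simp: non_AC_steps_def less_Suc_eq)
      then show ?thesis
        using IH AC[OF step True] by simp
    next
      case False
      then have "non_AC_steps (enat (Suc k)) g = insert k (non_AC_steps (enat k) g)"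
        by (auto simp: non_AC_steps_def less_Suc_eq)
      then show ?thesis
        using IH less[OF step False] by (simp add: non_AC_steps_def)
    qed
  qed
  \<comment> \<open>\<open>len\<close> may be infinite, and \<open>card\<close> of an infinite set
    is 0, so finiteness needs its own argument: bound all finite subsets first.\<close>
  have "card F \<le> f M" if "F \<subseteq> non_AC_steps len g" "finite F" for F
  proof (cases "F = {}")
    case False
    \<comment> \<open>The shortest prefix whose steps include all of \<open>F\<close>.\<close>
    define k where "k = Suc (Max F)"
    have "Max F \<in> F"
      using False that by simp
    then have "enat k \<le> len"
      using that by (auto simp: k_def non_AC_steps_def Suc_ile_eq)
    moreover have "F \<subseteq> non_AC_steps (enat k) g"
      using that by (auto simp: k_def non_AC_steps_def less_Suc_eq_le)
    then have "card F \<le> card (non_AC_steps (enat k) g)"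
      by (rule card_mono[rotated]) (simp add: non_AC_steps_def)
    ultimately show ?thesis
      using bound[of k] by simp
  qed simp
  \<comment> \<open>The witness depends on \<open>M\<close> alone; \<open>Suc\<close> turns the
    bound into a strict one.\<close>
  then show "finite (non_AC_steps len g) \<and> card (non_AC_steps len g) < Suc (f M)"
    using finite_if_finite_subsets_card_bdd[of "non_AC_steps len g" "f M"] by auto
qed

theorem theorem1:
  fixes R :: "rule_group \<Rightarrow> 'a::{ring, monoid_mult} tm \<Rightarrow> 'a tm \<Rightarrow> bool"
  assumes "R \<in> {step_a, step_l}"
  shows "AC_strongly_normalising R"
proof -
  have "AC_strongly_normalising (step_a :: rule_group \<Rightarrow> 'a tm \<Rightarrow> 'a tm \<Rightarrow> bool)"
    by (rule AC_strongly_normalising_if_measure[OF step_a_weight_AC step_a_weight_less])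
  moreover have "AC_strongly_normalising (step_l :: rule_group \<Rightarrow> 'a tm \<Rightarrow> 'a tm \<Rightarrow> bool)"
    by (rule AC_strongly_normalising_if_measure[OF step_l_weight_AC step_l_weight_less])
  ultimately show ?thesis
    using assms by auto
qed

end
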